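(* Let $T$ be a tree with at least two vertices. Then $F_t(T) \ge F(T) + 1$, with equality if and only if $T \in \mathcal{H}$.
   Context: All graphs are finite, simple and undirected. Forcing process: given a graph $G$ and an initial set $S \subseteq V(G)$ of colored vertices, at each step a colored vertex that has exactly one non-colored neighbor forces (colors) that neighbor. $S$ is a forcing set if iterating this eventually colors all of $V(G)$; $F(G)$ is the minimum cardinality of a forcing set. A total forcing set (TF-set) is a forcing set $S$ such that $G[S]$ has no isolated vertex; $F_t(G)$ is the minimum cardinality of a TF-set. Contracting an edge $xy$ replaces $x,y$ by one new vertex adjacent to all former neighbors of $x$ or $y$. For a tree $T$ with at least two vertices, the trimmed tree $\mathrm{trim}(T)$ is obtained by iteratively contracting edges having one end of degree exactly $2$ and the other end of degree at most $2$, until no such edge remains. The family $\mathcal{H}$ consists of all trees $T$ of order $n \ge 2$ such that $T \cong P_n$ (the path on $n$ vertices) or $\mathrm{trim}(T) \cong K_{1,k}$ for some $k \ge 3$. *)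

theory Defs
  imports "Graph_Theory.Graph_Theory"
begin

text \<open>
  A finite simple undirected graph is a \<^const>\<open>pair_graph\<close>: finite, loop-free, and with a symmetric
  arc relation, the edge \<open>xy\<close> being the two arcs \<open>(x, y)\<close> and \<open>(y, x)\<close>. The degree of a vertex is
  then its \<^const>\<open>out_degree\<close>.
\<close>

text \<open>
  The library's \<^const>\<open>tree\<close> does not apply to symmetric digraphs: there, every edge yields a
  directed cycle of length 2. In a \<^const>\<open>pair_graph\<close>, the directed cycles of length at least 3 are
  exactly the (oriented) cycles of the undirected graph.
\<close>

definition ugraph_tree :: "'a pair_pre_digraph \<Rightarrow> bool" where
  "ugraph_tree G \<longleftrightarrow> pair_graph G \<and> Digraph_Component.connected (with_proj G) \<and>
     \<not> (\<exists>p. pre_digraph.cycle (with_proj G) p \<and> 3 \<le> length p)"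

definition forcing_step :: "'a pair_pre_digraph \<Rightarrow> 'a set \<Rightarrow> 'a set \<Rightarrow> bool" where
  "forcing_step G S S' \<longleftrightarrow>
     (\<exists>u\<in>S. \<exists>v. {w. (u, w) \<in> parcs G \<and> w \<notin> S} = {v} \<and> S' = insert v S)"

definition forcing_set :: "'a pair_pre_digraph \<Rightarrow> 'a set \<Rightarrow> bool" where
  "forcing_set G S \<longleftrightarrow> S \<subseteq> pverts G \<and> (forcing_step G)\<^sup>*\<^sup>* S (pverts G)"

definition forcing_number :: "'a pair_pre_digraph \<Rightarrow> nat" where
  "forcing_number G = (LEAST k. \<exists>S. forcing_set G S \<and> card S = k)"

definition total_forcing_set :: "'a pair_pre_digraph \<Rightarrow> 'a set \<Rightarrow> bool" where
  "total_forcing_set G S \<longleftrightarrow> forcing_set G S \<and>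
     (\<forall>v \<in> verts (with_proj G \<restriction> S). out_degree (with_proj G \<restriction> S) v \<noteq> 0)"

text \<open>
  A graph has a total forcing set if and only if it has no isolated vertex; otherwise the following
  number carries no meaning.
\<close>

definition total_forcing_number :: "'a pair_pre_digraph \<Rightarrow> nat" where
  "total_forcing_number G = (LEAST k. \<exists>S. total_forcing_set G S \<and> card S = k)"

text \<open>
  Contraction of the edge \<open>xy\<close>; the vertex resulting from the identification is again called \<open>x\<close>.
\<close>

definition contract_edge :: "'a pair_pre_digraph \<Rightarrow> 'a \<Rightarrow> 'a \<Rightarrow> 'a pair_pre_digraph" where
  "contract_edge G x y =
     (let r = (\<lambda>v. if v = y then x else v) in
      \<lparr> pverts = r ` pverts G,
        parcs = {(r u, r v) |u v. (u, v) \<in> parcs G \<and> r u \<noteq> r v} \<rparr>)"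

definition trimmable_edge :: "'a pair_pre_digraph \<Rightarrow> 'a \<Rightarrow> 'a \<Rightarrow> bool" where
  "trimmable_edge G x y \<longleftrightarrow>
     (x, y) \<in> parcs G \<and> out_degree (with_proj G) x = 2 \<and> out_degree (with_proj G) y \<le> 2"

definition trim_step :: "'a pair_pre_digraph \<Rightarrow> 'a pair_pre_digraph \<Rightarrow> bool" where
  "trim_step G H \<longleftrightarrow> (\<exists>x y. trimmable_edge G x y \<and> H = contract_edge G x y)"

text \<open>
  The trimmed tree is determined only up to isomorphism, since the edges may be contracted in any
  order; hence a relation instead of a function.
\<close>

definition is_trim :: "'a pair_pre_digraph \<Rightarrow> 'a pair_pre_digraph \<Rightarrow> bool" where
  "is_trim T T' \<longleftrightarrow> trim_step\<^sup>*\<^sup>* T T' \<and> \<not> (\<exists>x y. trimmable_edge T' x y)"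

definition path_graph :: "nat \<Rightarrow> nat pair_pre_digraph" where
  "path_graph n =
     \<lparr> pverts = {..<n}, parcs = {(i, j). i < n \<and> j < n \<and> (j = Suc i \<or> i = Suc j)} \<rparr>"

text \<open>
  The library predicate \<^const>\<open>complete_bipartite_digraph\<close> is closed under isomorphism, so
  \<open>complete_bipartite_digraph 1 k\<close> says that its argument is isomorphic to the star \<open>K\<^bsub>1,k\<^esub>\<close>.
\<close>

definition family_H :: "'a pair_pre_digraph set" where
  "family_H = {T. ugraph_tree T \<and> 2 \<le> card (pverts T) \<and>
     (digraph_iso (with_proj T) (with_proj (path_graph (card (pverts T)))) \<or>
      (\<exists>T' k. is_trim T T' \<and> 3 \<le> k \<and> complete_bipartite_digraph 1 k (with_proj T')))}"

end

theory Submission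
  imports Defs
begin

text \<open>
  Let \<open>V\<close> and \<open>E\<close> be the vertex set and the edge set of the tree. Only two consequences of being a
  tree matter: it is connected, and every nonempty set of edges covers more vertices than it has
  edges. The edges along which a forcing set \<open>S\<close> forces form a linear forest (all degrees at most 2)
  with \<open>\<bar>V\<bar> - \<bar>S\<bar>\<close> edges, in which the vertices of \<open>S\<close> have degree at most 1. Conversely, every linear
  forest \<open>L \<subseteq> E\<close> comes from a forcing set with \<open>\<bar>V\<bar> - \<bar>L\<bar>\<close> vertices. Hence a matching \<open>K\<close> between vertices
  of \<open>S\<close> can be added to the forest, and there is a forcing set with \<open>\<bar>S\<bar> - \<bar>K\<bar>\<close> vertices. A single edge
  inside a total forcing set gives the inequality. If equality holds, then a minimum total forcing
  set contains no two disjoint edges, so it spans a star; this star and the linear forest together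
  have \<open>\<bar>V\<bar> - 1\<close> edges, hence exhaust \<open>E\<close>, and so all vertices but the center of the star have degree at
  most 2. Such trees are the paths and the subdivided stars, that is, the members of the family.
\<close>

section \<open>Sparse edge sets\<close>

text \<open>The two arcs of an undirected edge become one set, so that \<open>card\<close> counts
  every edge once.\<close>

definition edges :: "'a pair_pre_digraph \<Rightarrow> 'a set set" where
  "edges G = (\<lambda>(u, v). {u, v}) ` parcs G"

definition edeg :: "'a set set \<Rightarrow> 'a \<Rightarrow> nat" where
  "edeg F v = card {e \<in> F. v \<in> e}"

lemma edeg_empty [simp]: "edeg {} v = 0"
  by (simp add: edeg_def)

lemma edeg_insert:
  assumes "finite F" "e \<notin> F"
  shows "edeg (insert e F) v = edeg F v + (if v \<in> e then 1 else 0)"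
proof -
  have "{a \<in> insert e F. v \<in> a} = (if v \<in> e then insert e {a \<in> F. v \<in> a} else {a \<in> F. v \<in> a})"
    by auto
  then show ?thesis using assms by (simp add: edeg_def)
qed

lemma edeg_Un_disjoint:
  assumes "finite F" "finite F'" "F \<inter> F' = {}"
  shows "edeg (F \<union> F') v = edeg F v + edeg F' v"
proof -
  have "{a \<in> F \<union> F'. v \<in> a} = {a \<in> F. v \<in> a} \<union> {a \<in> F'. v \<in> a}" by auto
  then show ?thesis using assms by (simp add: edeg_def) (subst card_Un_disjoint, auto)
qed

lemma edeg_eq_0: "finite F \<Longrightarrow> edeg F v = 0 \<longleftrightarrow> v \<notin> \<Union>F"
  by (auto simp: edeg_def)

text \<open>The handshake identity: count the incident pairs of a vertex and an edge in both
  orders.\<close>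

lemma sum_edeg:
  assumes "finite F" "\<And>e. e \<in> F \<Longrightarrow> card e = 2"
  shows "(\<Sum>v\<in>\<Union>F. edeg F v) = 2 * card F"
proof -
  have fin: "finite (\<Union>F)"
    using assms by (metis card.infinite finite_Union zero_neq_numeral)
  have "(\<Sum>v\<in>\<Union>F. edeg F v) = (\<Sum>v\<in>\<Union>F. \<Sum>e\<in>{e \<in> F. v \<in> e}. 1)"
    by (simp add: edeg_def)
  also have "\<dots> = (\<Sum>e\<in>F. \<Sum>v\<in>{v \<in> \<Union>F. v \<in> e}. 1)"
    using fin assms(1) by (rule sum.swap_restrict)
  also have "\<dots> = (\<Sum>e\<in>F. 2)"
  proof (rule sum.cong)
    fix e assume e: "e \<in> F"
    then have "{v \<in> \<Union>F. v \<in> e} = e" by auto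
    then show "(\<Sum>v\<in>{v \<in> \<Union>F. v \<in> e}. 1) = (2::nat)" using assms(2)[OF e] by simp
  qed simp
  finally show ?thesis by simp
qed

text \<open>Distinct lists in \<open>V\<close> have length at most \<open>card V\<close>, so there
  is a longest \<open>R\<close>-chain; an extension at either end would be longer. It serves to find
  leaves and, later, spanning paths.\<close>

lemma maximal_path_exists:
  assumes "finite V" "v \<in> V"
  obtains p where "p \<noteq> []" "distinct p" "set p \<subseteq> V" "successively R p"
    "\<And>y. y \<in> V \<Longrightarrow> R y (hd p) \<Longrightarrow> y \<in> set p"
    "\<And>y. y \<in> V \<Longrightarrow> R (last p) y \<Longrightarrow> y \<in> set p"
proof -
  let ?Q = "\<lambda>p. p \<noteq> [] \<and> set p \<subseteq> V \<and> distinct p \<and> successively R p"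
  have bd: "length q \<le> card V" if "?Q q" for q
    using that assms(1) by (metis card_mono distinct_card)
  have "?Q [v]" using assms by simp
  then obtain p where p: "?Q p" and max: "\<And>q. ?Q q \<Longrightarrow> length q \<le> length p"
    using ex_has_greatest_nat[of ?Q "[v]" length "Suc (card V)"] bd by (metis less_Suc_eq_le)
  show thesis
  proof (rule that[of p])
    fix y assume y: "y \<in> V" "R y (hd p)"
    show "y \<in> set p"
    proof (rule ccontr)
      assume "y \<notin> set p"
      then have "?Q (y # p)" using p y by (auto simp: successively_Cons)
      from max[OF this] show False by simp
    qed
  next
    fix y assume y: "y \<in> V" "R (last p) y"
    show "y \<in> set p"
    proof (rule ccontr)
      assume "y \<notin> set p"
      then have "?Q (p @ [y])" using p y by (auto simp: successively_append_iff)
      from max[OF this] show False by simp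
    qed
  qed (use p in auto)
qed

text \<open>Walks in the library are lists of arcs; zipping a vertex list with its tail produces the
  walk through it.\<close>

lemma zip_tl_walk:
  assumes "q \<noteq> []" "successively (\<lambda>u v. (u, v) \<in> A) q"
  shows "pcas (hd q) (zip q (tl q)) (last q) \<and> pawalk_verts (hd q) (zip q (tl q)) = q
    \<and> set (zip q (tl q)) \<subseteq> A"
  using assms
proof (induction q)
  case (Cons x q)
  then show ?case by (cases q) auto
qed simp

section \<open>Acyclic edge sets of an undirected graph\<close>

context pair_graph
begin

lemma in_edges_iff: "{u, v} \<in> edges G \<longleftrightarrow> (u, v) \<in> parcs G"
  using arcs_symmetric by (auto simp: edges_def doubleton_eq_iff)

lemma edgesE:
  assumes "e \<in> edges G"
  obtains u v where "e = {u, v}" "u \<noteq> v" "(u, v) \<in> parcs G" "u \<in> pverts G" "v \<in> pverts G"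
  using assms no_loops' in_arcsD1 in_arcsD2 unfolding edges_def by fast

lemma finite_edges: "finite (edges G)"
  by (simp add: edges_def pair_finite_arcs)

lemma card_edge: "e \<in> edges G \<Longrightarrow> card e = 2"
  by (auto elim!: edgesE)

lemma Union_edges_subset: "\<Union>(edges G) \<subseteq> pverts G"
  by (auto elim!: edgesE)

lemma edge_through: "e \<in> edges G \<Longrightarrow> x \<in> e \<Longrightarrow> \<exists>y. e = {x, y} \<and> x \<noteq> y \<and> (x, y) \<in> parcs G"
  by (erule edgesE) (auto intro: arcs_symmetric)

lemma edeg_edges: "edeg (edges G) x = card {y. (x, y) \<in> parcs G}"
proof -
  have "{e \<in> edges G. x \<in> e} = (\<lambda>y. {x, y}) ` {y. (x, y) \<in> parcs G}"
    using edge_through in_edges_iff by blast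
  moreover have "inj_on (\<lambda>y. {x, y}) {y. (x, y) \<in> parcs G}"
    by (auto simp: inj_on_def doubleton_eq_iff)
  ultimately show ?thesis by (simp add: edeg_def card_image)
qed

lemma out_degree_eq: "out_degree (with_proj G) x = edeg (edges G) x"
proof -
  have "out_arcs (with_proj G) x = Pair x ` {y. (x, y) \<in> parcs G}"
    by (auto simp: out_arcs_def)
  then show ?thesis by (simp add: out_degree_def edeg_edges card_image inj_on_def)
qed

lemma finite_neighbors: "finite {y. (x, y) \<in> parcs G}"
  using pair_finite_verts by (rule rev_finite_subset) (auto intro: in_arcsD2)

lemma closed_path_cycle:
  assumes "distinct q" "3 \<le> length q" "successively (\<lambda>u v. (u, v) \<in> parcs G) q"
    "(last q, hd q) \<in> parcs G"
  shows "\<exists>p. cycle p \<and> 3 \<le> length p"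
proof -
  \<comment> \<open>The closing arc comes first: dropping the first vertex of the walk then leaves
    exactly \<open>q\<close>, whose distinctness is what \<open>cycle\<close> demands.\<close>
  let ?p = "(last q, hd q) # zip q (tl q)"
  have ne: "q \<noteq> []" using assms by auto
  have "pcas (last q) ?p (last q)" "tl (pawalk_verts (last q) ?p) = q" "set ?p \<subseteq> parcs G"
    using zip_tl_walk[OF ne assms(3)] assms(4) by auto
  then have "cycle ?p"
    unfolding cycle_def awalk_def using assms in_arcsD1[OF assms(4)] by (intro exI[of _ "last q"]) auto
  moreover have "3 \<le> length ?p" using assms by simp
  ultimately show ?thesis by blast
qed

text \<open>The leaf is the head of a maximal path in \<open>F\<close>. By maximality its neighbors
  lie on the path, and a neighbor other than the second vertex would close an initial segment to a
  cycle of length at least 3.\<close>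

lemma acyclic_leaf:
  assumes acyclic: "\<not> (\<exists>p. cycle p \<and> 3 \<le> length p)" and F: "F \<subseteq> edges G" "F \<noteq> {}"
  obtains x where "edeg F x = 1"
proof -
  from F obtain e where "e \<in> F" by blast
  with F obtain v where v: "v \<in> \<Union>F" by (blast elim: edgesE)
  have "finite (\<Union>F)" using F Union_edges_subset pair_finite_verts by (meson Union_mono finite_subset)
  from maximal_path_exists[OF this v, of "\<lambda>u v. {u, v} \<in> F"]
  obtain p where p: "p \<noteq> []" "distinct p" "set p \<subseteq> \<Union>F" "successively (\<lambda>u v. {u, v} \<in> F) p"
    and max: "\<And>y. y \<in> \<Union>F \<Longrightarrow> {y, hd p} \<in> F \<Longrightarrow> y \<in> set p" by metis
  define x where "x = hd p"
  have only: "y = p ! 1" if y: "{x, y} \<in> F" for y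
  proof (rule ccontr)
    assume y1: "y \<noteq> p ! 1"
    have arc: "(x, y) \<in> parcs G" using y F in_edges_iff by blast
    then have "x \<noteq> y" using no_loops' by blast
    have "y \<in> set p" using max[of y] y by (auto simp: x_def insert_commute)
    then obtain j where j: "j < length p" "p ! j = y" by (auto simp: in_set_conv_nth)
    have "p ! 0 = x" using p by (simp add: x_def hd_conv_nth)
    then have j2: "2 \<le> j" using j y1 \<open>x \<noteq> y\<close>
      by (metis One_nat_def less_2_cases not_less)
    let ?q = "take (Suc j) p"
    have "successively (\<lambda>u v. (u, v) \<in> parcs G) p"
      using p(4) by (rule successively_mono) (use F in_edges_iff in blast)
    then have "successively (\<lambda>u v. (u, v) \<in> parcs G) ?q"
      by (metis append_take_drop_id successively_append_iff)
    moreover have "hd ?q = x" "last ?q = y"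
      using j p(1) by (auto simp: x_def last_conv_nth)
    ultimately show False
      using closed_path_cycle[of ?q] acyclic p(2) j j2 arcs_symmetric[OF arc] by auto
  qed
  have "x \<in> \<Union>F" using p(1,3) list.set_sel(1) unfolding x_def by blast
  then obtain e where e: "e \<in> F" "x \<in> e" by blast
  have "e' = {x, p ! 1}" if "e' \<in> F" "x \<in> e'" for e'
    using edge_through[of e' x] that F only by blast
  then have "{e \<in> F. x \<in> e} = {{x, p ! 1}}" using e by blast
  then have "edeg F x = 1" by (simp add: edeg_def)
  then show thesis by (rule that)
qed

text \<open>Deleting the only edge at a leaf costs one edge and at least one covered vertex, so the
  strict inequality passes from the remaining edges to \<open>F\<close>.\<close>

lemma acyclic_sparse:
  assumes acyclic: "\<not> (\<exists>p. cycle p \<and> 3 \<le> length p)" and F: "F \<subseteq> edges G" "F \<noteq> {}"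
  shows "card F < card (\<Union>F)"
  using F
proof (induction "card F" arbitrary: F rule: less_induct)
  case less
  have fin: "finite F" using less finite_edges finite_subset by blast
  have finU: "finite (\<Union>F)"
    using less Union_edges_subset pair_finite_verts by (meson Union_mono finite_subset)
  obtain x where x: "edeg F x = 1" using acyclic_leaf[OF acyclic less.prems] .
  then obtain e where e: "{a \<in> F. x \<in> a} = {e}" unfolding edeg_def by (auto simp: card_1_singleton_iff)
  then have eF: "e \<in> F" "x \<in> e" by auto
  have cF: "card F = Suc (card (F - {e}))" using fin eF by (metis card_Suc_Diff1)
  show ?case
  proof (cases "F = {e}")
    case True
    then show ?thesis using card_edge[of e] less.prems by simp
  next
    case False
    then have "F - {e} \<noteq> {}" "F - {e} \<subseteq> edges G" using eF(1) less.prems(1) by blast+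
    moreover have "card (F - {e}) < card F" using cF by simp
    ultimately have "card (F - {e}) < card (\<Union>(F - {e}))" using less.hyps by simp
    moreover have "\<Union>(F - {e}) \<subset> \<Union>F" using e eF by auto
    then have "card (\<Union>(F - {e})) < card (\<Union>F)" using finU by (rule psubset_card_mono[rotated])
    ultimately show ?thesis using cF by linarith
  qed
qed

end

text \<open>Sparsity stands for acyclicity, the closure property for connectedness. Both pass to
  contracted graphs by counting and by preimages, without handling walks or cycles, so the argument
  can follow the trimming.\<close>

locale sparse_connected = pair_graph +
  assumes sparse: "\<And>F. F \<subseteq> edges G \<Longrightarrow> F \<noteq> {} \<Longrightarrow> card F < card (\<Union>F)"
    and closed_eq_verts: "\<And>X. X \<subseteq> pverts G \<Longrightarrow> X \<noteq> {} \<Longrightarrow>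
      (\<And>u v. u \<in> X \<Longrightarrow> (u, v) \<in> parcs G \<Longrightarrow> v \<in> X) \<Longrightarrow> X = pverts G"

text \<open>Connectedness is defined through the symmetric closure, which here has the same arcs as
  \<open>G\<close>; a closed set absorbs all that is reachable from one of its elements.\<close>

lemma ugraph_tree_sparse_connected:
  assumes "ugraph_tree G"
  shows "sparse_connected G"
proof -
  interpret pair_graph G using assms by (simp add: ugraph_tree_def)
  show ?thesis
  proof unfold_locales
    fix F :: "'a set set"
    assume "F \<subseteq> edges G" "F \<noteq> {}"
    then show "card F < card (\<Union>F)"
      using assms acyclic_sparse unfolding ugraph_tree_def by blast
  next
    fix X assume X: "X \<subseteq> pverts G" "X \<noteq> {}" and cl: "\<And>u v. u \<in> X \<Longrightarrow> (u, v) \<in> parcs G \<Longrightarrow> v \<in> X"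
    obtain x where x: "x \<in> X" using X by blast
    have "v \<in> X" if v: "v \<in> pverts G" for v
    proof -
      have "strongly_connected (mk_symmetric (with_proj G))"
        using assms by (simp add: ugraph_tree_def connected_def)
      then have "(x, v) \<in> rtrancl_on (pverts G) (parcs (mk_symmetric (with_proj G)))"
        using X x v by (auto simp: strongly_connected_def reachable_def mk_symmetric_def)
      moreover have "parcs (mk_symmetric (with_proj G)) = parcs G"
        using arcs_symmetric by (fastforce simp: mk_symmetric_def)
      ultimately have "(x, v) \<in> rtrancl_on (pverts G) (parcs G)" by simp
      from this x show "v \<in> X" by induction (auto intro: cl)
    qed
    then show "X = pverts G" using X by blast
  qed
qed

section \<open>Forcing sets and linear forests\<close>

text \<open>\<open>P\<close> is an invariant under which the process cannot get stuck; the induction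
  is on the number of uncolored vertices.\<close>

lemma forcing_setI:
  assumes "finite (pverts G)" "S \<subseteq> pverts G" "P S"
    and step: "\<And>A. P A \<Longrightarrow> A \<subset> pverts G \<Longrightarrow> \<exists>u\<in>A. \<exists>v\<in>pverts G. {w. (u, w) \<in> parcs G \<and> w \<notin> A} = {v} \<and> P (insert v A)"
  shows "forcing_set G S"
proof -
  have "(forcing_step G)\<^sup>*\<^sup>* A (pverts G)" if "P A" "A \<subseteq> pverts G" for A
    using that
  proof (induction "card (pverts G - A)" arbitrary: A rule: less_induct)
    case less
    show ?case
    proof (cases "A = pverts G")
      case False
      then obtain u v where uv: "u \<in> A" "v \<in> pverts G" "{w. (u, w) \<in> parcs G \<and> w \<notin> A} = {v}"
        "P (insert v A)" using step[of A] less.prems by blast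
      then have "v \<notin> A" by blast
      then have "pverts G - insert v A \<subset> pverts G - A" using uv by blast
      then have "card (pverts G - insert v A) < card (pverts G - A)"
        using assms(1) by (intro psubset_card_mono) auto
      then have "(forcing_step G)\<^sup>*\<^sup>* (insert v A) (pverts G)"
        using less uv by simp
      moreover have "forcing_step G A (insert v A)" using uv by (auto simp: forcing_step_def)
      ultimately show ?thesis by (rule converse_rtranclp_into_rtranclp[rotated])
    qed simp
  qed
  then show ?thesis using assms by (simp add: forcing_set_def)
qed

context sparse_connected
begin

lemma card_edges_less:
  assumes "pverts G \<noteq> {}"
  shows "card (edges G) < card (pverts G)"
proof (cases "edges G = {}")
  case True
  then show ?thesis using assms pair_finite_verts by (simp add: card_gt_0_iff)
next
  case False
  then have "card (edges G) < card (\<Union>(edges G))" using sparse by blast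
  also have "\<dots> \<le> card (pverts G)" using Union_edges_subset pair_finite_verts by (rule card_mono[rotated])
  finally show ?thesis .
qed

text \<open>If all covered vertices had degree at least 2, the handshake identity would give at
  least as many edges as covered vertices.\<close>

lemma sparse_leaf:
  assumes "F \<subseteq> edges G" "F \<noteq> {}"
  obtains x where "edeg F x = 1"
proof (rule ccontr)
  assume "\<not> thesis"
  then have ne: "edeg F x \<noteq> 1" for x using that by blast
  have fin: "finite F" using assms finite_edges finite_subset by blast
  have "edeg F x \<ge> 2" if "x \<in> \<Union>F" for x
    using that ne[of x] edeg_eq_0[OF fin, of x] by linarith
  then have "(\<Sum>x\<in>\<Union>F. 2) \<le> (\<Sum>x\<in>\<Union>F. edeg F x)" by (intro sum_mono) auto
  also have "\<dots> = 2 * card F" using fin card_edge assms by (intro sum_edeg) auto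
  finally show False using sparse[OF assms] by simp
qed

text \<open>Each path of the forest is directed from one end to the other. The induction removes the
  edge at a leaf \<open>w\<close> and puts it back pointing away from \<open>w\<close>, or towards
  \<open>w\<close> if its other end \<open>z\<close> already has a predecessor.\<close>

lemma orient_linear_forest:
  assumes "L \<subseteq> edges G" "\<And>v. edeg L v \<le> 2"
  obtains M where "(\<lambda>(u, v). {u, v}) ` M = L" "inj_on (\<lambda>(u, v). {u, v}) M" "inj_on fst M" "inj_on snd M"
proof -
  have "\<exists>M. (\<lambda>(u, v). {u, v}) ` M = L \<and> inj_on (\<lambda>(u, v). {u, v}) M \<and> inj_on fst M \<and> inj_on snd M"
    using assms
  proof (induction "card L" arbitrary: L rule: less_induct)
    case less
    show ?case
    proof (cases "L = {}")
      case False
      have fin: "finite L" using less finite_edges finite_subset by blast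
      obtain w where w: "edeg L w = 1" using sparse_leaf[OF less.prems(1) False] .
      then obtain e where e: "{a \<in> L. w \<in> a} = {e}"
        unfolding edeg_def by (auto simp: card_1_singleton_iff)
      then have eL: "e \<in> L" "w \<in> e" by auto
      then obtain z where z: "e = {w, z}" "w \<noteq> z" using edge_through less.prems(1) by blast
      define L' where "L' = L - {e}"
      have L: "L = insert e L'" "e \<notin> L'" "finite L'" using eL fin by (auto simp: L'_def)
      have deg: "edeg L v = edeg L' v + (if v \<in> e then 1 else 0)" for v
        unfolding L(1) using L(2,3) by (rule edeg_insert[rotated])
      have "edeg L' v \<le> 2" for v using less.prems(2)[of v] deg[of v] by linarith
      moreover have "card L' < card L" using L by simp
      moreover have L'E: "L' \<subseteq> edges G" using less.prems L by blast
      ultimately have "\<exists>M. (\<lambda>(u, v). {u, v}) ` M = L' \<and> inj_on (\<lambda>(u, v). {u, v}) M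
        \<and> inj_on fst M \<and> inj_on snd M"
        by (intro less.hyps)
      then obtain M where M: "(\<lambda>(u, v). {u, v}) ` M = L'" "inj_on (\<lambda>(u, v). {u, v}) M"
        "inj_on fst M" "inj_on snd M"
        by (elim exE conjE)
      have in_L: "{u, v} \<in> L'" if "(u, v) \<in> M" for u v using that M(1) by force
      have w0: "(w, a) \<notin> M" "(a, w) \<notin> M" for a
      proof -
        have "w \<notin> \<Union>L'" using e unfolding L'_def by blast
        then show "(w, a) \<notin> M" "(a, w) \<notin> M" using in_L by blast+
      qed
      have eM: "(w, z) \<notin> M" "(z, w) \<notin> M" using w0 by auto
      show ?thesis
      proof (cases "z \<in> snd ` M")
        case False
        have "inj_on fst (insert (w, z) M)" "inj_on snd (insert (w, z) M)"
          using M w0 False by (auto simp: inj_on_insert)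
        moreover have "(\<lambda>(u, v). {u, v}) ` insert (w, z) M = L" using M(1) L(1) z by simp
        moreover have "inj_on (\<lambda>(u, v). {u, v}) (insert (w, z) M)"
          using M(1,2) L(2) z by (auto simp: inj_on_insert simp del: insert_iff)
        ultimately show ?thesis by blast
      next
        case True
        then obtain b where b: "(b, z) \<in> M" by auto
        \<comment> \<open>In \<open>L'\<close> the vertex \<open>z\<close> has degree at most 1, so
          an arc leaving \<open>z\<close> would come from the same edge as the arc entering it; the
          two arcs would coincide and form a loop.\<close>
        have "z \<notin> fst ` M"
        proof
          assume "z \<in> fst ` M"
          then obtain a where a: "(z, a) \<in> M" by auto
          have "edeg L' z \<le> 1" using less.prems(2)[of z] deg[of z] z by simp
          then have "card {e \<in> L'. z \<in> e} \<le> Suc 0" by (simp add: edeg_def)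
          then have "x = y" if "x \<in> L'" "z \<in> x" "y \<in> L'" "z \<in> y" for x y
            using that L(3) by (simp add: card_le_Suc0_iff_eq)
          then have "{z, a} = {b, z}" using in_L[OF a] in_L[OF b] by simp
          then have "(z, a) = (b, z)" using inj_onD[OF M(2), of "(z, a)" "(b, z)"] a b by simp
          then have "{z} \<in> edges G" using in_L[OF a] L'E by auto
          then show False using card_edge[of "{z}"] by simp
        qed
        then have "inj_on fst (insert (z, w) M)" "inj_on snd (insert (z, w) M)"
          using M w0 by (auto simp: inj_on_insert)
        moreover have "(\<lambda>(u, v). {u, v}) ` insert (z, w) M = L" using M(1) L(1) z by (simp add: insert_commute)
        moreover have "inj_on (\<lambda>(u, v). {u, v}) (insert (z, w) M)"
          using M(1,2) L(2) z by (auto simp: inj_on_insert insert_commute simp del: insert_iff)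
        ultimately show ?thesis by blast
      qed
    qed auto
  qed
  then show thesis using that by blast
qed

text \<open>
  Orient \<open>L\<close> as a partial injection \<open>M\<close> and start from the vertices without a predecessor. If the
  process got stuck, each uncolored vertex would have an edge to its predecessor, and each colored
  vertex with an uncolored successor would have an edge to a further uncolored vertex: as many edges
  as vertices, which sparsity forbids.
\<close>

lemma forcing_set_of_linear_forest:
  assumes L: "L \<subseteq> edges G" "\<And>v. edeg L v \<le> 2"
  obtains S where "forcing_set G S" "card S + card L = card (pverts G)"
proof -
  obtain M where M: "(\<lambda>(u, v). {u, v}) ` M = L" "inj_on (\<lambda>(u, v). {u, v}) M" "inj_on fst M" "inj_on snd M"
    using orient_linear_forest[OF L] .
  have arcM: "(u, v) \<in> parcs G" if "(u, v) \<in> M" for u v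
    using that M(1) L(1) in_edges_iff by force
  have finM: "finite M"
    using pair_finite_arcs by (rule rev_finite_subset) (use arcM in auto)
  define S where "S = pverts G - snd ` M"
  have sub: "snd ` M \<subseteq> pverts G" using in_arcsD2[OF arcM] by auto
  have "card (snd ` M) = card L" using card_image[OF M(2)] card_image[OF M(4)] M(1) by simp
  moreover have "card S + card (snd ` M) = card (pverts G)"
    using card_Diff_subset[OF _ sub] card_mono[OF pair_finite_verts sub] finM by (simp add: S_def)
  ultimately have "card S + card L = card (pverts G)" by simp
  moreover have "forcing_set G S"
  proof (rule forcing_setI[where P = "\<lambda>A. S \<subseteq> A"])
    fix A assume A: "S \<subseteq> A" "A \<subset> pverts G"
    define U where "U = pverts G - A"
    have U: "U \<noteq> {}" "U \<subseteq> snd ` M" "finite U" using A pair_finite_verts by (auto simp: U_def S_def)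
    show "\<exists>u\<in>A. \<exists>v\<in>pverts G. {w. (u, w) \<in> parcs G \<and> w \<notin> A} = {v} \<and> S \<subseteq> insert v A"
    proof (rule ccontr)
      assume stuck: "\<not> ?thesis"
      define C where "C = {x \<in> A. \<exists>z\<in>U. (x, z) \<in> M}"
      have "\<exists>y. y \<in> U \<and> (x, y) \<in> parcs G \<and> (x, y) \<notin> M" if x: "x \<in> C" for x
      proof (rule ccontr)
        assume none: "\<not> ?thesis"
        obtain z where z: "x \<in> A" "z \<in> U" "(x, z) \<in> M" using x by (auto simp: C_def)
        have "{w. (x, w) \<in> parcs G \<and> w \<notin> A} = {z}"
        proof (intro equalityI subsetI)
          fix w assume "w \<in> {w. (x, w) \<in> parcs G \<and> w \<notin> A}"
          then have "(x, w) \<in> M" using none in_arcsD2[of x w] by (auto simp: U_def)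
          then show "w \<in> {z}" using inj_onD[OF M(3), of "(x, w)" "(x, z)"] z by auto
        qed (use z arcM in \<open>auto simp: U_def\<close>)
        then show False using stuck z A by (auto simp: U_def)
      qed
      then obtain g where g: "\<And>x. x \<in> C \<Longrightarrow> g x \<in> U \<and> (x, g x) \<in> parcs G \<and> (x, g x) \<notin> M" by metis
      define K where "K = {a \<in> M. snd a \<in> U}"
      define K' where "K' = (\<lambda>x. (x, g x)) ` C"
      define f :: "'a \<times> 'a \<Rightarrow> 'a set" where "f = (\<lambda>(u, v). {u, v})"
      define F where "F = f ` (K \<union> K')"
      have "C \<inter> U = {}" by (auto simp: C_def U_def)
      have finC: "finite C" using A pair_finite_verts by (auto simp: C_def intro: finite_subset)
      have finK: "finite K" "finite K'" using finM finC by (auto simp: K_def K'_def)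
      have "card K = card U"
      proof -
        have "snd ` K = U" using U by (auto simp: K_def)
        moreover have "inj_on snd K" using M(4) by (rule inj_on_subset) (auto simp: K_def)
        ultimately show ?thesis by (metis card_image)
      qed
      moreover have "card K' = card C" unfolding K'_def by (rule card_image) (auto simp: inj_on_def)
      moreover have "K \<inter> K' = {}" using g by (auto simp: K_def K'_def)
      ultimately have cK: "card (K \<union> K') = card U + card C" using finK by (simp add: card_Un_disjoint)
      \<comment> \<open>All arcs here end in \<open>U\<close>, while those of \<open>K'\<close>
        start in \<open>C\<close>, outside \<open>U\<close>. So no arc of \<open>K'\<close> is the
        reverse of another, and for two arcs of \<open>M\<close> injectivity holds by the choice of
        \<open>M\<close>.\<close>
      have inj_f: "inj_on f (K \<union> K')"
      proof (rule inj_onI)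
        have fM: "f (u, v) = {u, v}" for u v by (simp add: f_def)
        fix a b assume ab: "a \<in> K \<union> K'" "b \<in> K \<union> K'" "f a = f b"
        obtain u v x y where uv: "a = (u, v)" "b = (x, y)" by (cases a, cases b)
        have cases_K: "c \<in> K \<Longrightarrow> c \<in> M \<and> snd c \<in> U"
          "c \<in> K' \<Longrightarrow> c \<notin> M \<and> fst c \<in> C \<and> fst c \<notin> U \<and> snd c = g (fst c) \<and> snd c \<in> U" for c
          using g \<open>C \<inter> U = {}\<close> by (auto simp: K_def K'_def)
        consider "a \<in> M" "b \<in> M" | "a \<in> K'" "b \<in> K'" | "a \<in> K" "b \<in> K'" | "a \<in> K'" "b \<in> K"
          using ab cases_K by blast
        then show "a = b"
        proof cases
          case 1
          then show ?thesis using inj_onD[OF M(2)] ab(3) by (simp add: f_def)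
        next
          case 2
          then show ?thesis using cases_K(2)[of a] cases_K(2)[of b] ab(3) uv
            by (auto simp: fM doubleton_eq_iff)
        next
          case 3
          then show ?thesis using cases_K(1)[of a] cases_K(2)[of b] ab(3) uv
            by (auto simp: fM doubleton_eq_iff)
        next
          case 4
          then show ?thesis using cases_K(2)[of a] cases_K(1)[of b] ab(3) uv
            by (auto simp: fM doubleton_eq_iff)
        qed
      qed
      then have "card F = card U + card C" unfolding F_def using cK inj_f by (simp add: card_image)
      moreover have "F \<subseteq> edges G"
        using arcM g by (auto simp: F_def K_def K'_def f_def in_edges_iff)
      moreover have "F \<noteq> {}" using \<open>card K = card U\<close> U by (auto simp: F_def)
      ultimately have "card U + card C < card (\<Union>F)" using sparse by metis
      also have "\<Union>F \<subseteq> U \<union> C"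
      proof -
        have uM: "u \<in> U \<union> C" if "(u, v) \<in> M" "v \<in> U" for u v
          using that in_arcsD1[OF arcM] by (auto simp: U_def C_def)
        then show ?thesis using g by (auto simp: F_def f_def K_def K'_def dest: uM)
      qed
      then have "card (\<Union>F) \<le> card (U \<union> C)" using U finC by (intro card_mono) auto
      also have "\<dots> \<le> card U + card C" by (rule card_Un_le)
      finally show False by simp
    qed
  qed (auto simp: S_def pair_finite_verts)
  ultimately show thesis using that by blast
qed

end

section \<open>The minima and total forcing sets\<close>

lemma forcing_number_le: "forcing_set G S \<Longrightarrow> forcing_number G \<le> card S"
  unfolding forcing_number_def by (rule Least_le) blast

lemma forcing_number_attained:
  assumes "forcing_set G S"
  obtains S' where "forcing_set G S'" "card S' = forcing_number G"
  using LeastI_ex[of "\<lambda>k. \<exists>S. forcing_set G S \<and> card S = k"] assms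
  unfolding forcing_number_def by blast

lemma total_forcing_number_le: "total_forcing_set G S \<Longrightarrow> total_forcing_number G \<le> card S"
  unfolding total_forcing_number_def by (rule Least_le) blast

lemma total_forcing_number_attained:
  assumes "total_forcing_set G S"
  obtains S' where "total_forcing_set G S'" "card S' = total_forcing_number G"
  using LeastI_ex[of "\<lambda>k. \<exists>S. total_forcing_set G S \<and> card S = k"] assms
  unfolding total_forcing_number_def by blast

lemma forcing_set_verts: "forcing_set G (pverts G)"
  by (simp add: forcing_set_def)

text \<open>In a tree, this includes the paths, where every vertex is a center.\<close>

definition spider_center :: "'a pair_pre_digraph \<Rightarrow> 'a \<Rightarrow> bool" where
  "spider_center G c \<longleftrightarrow> c \<in> pverts G \<and> (\<forall>v. v \<noteq> c \<longrightarrow> edeg (edges G) v \<le> 2)"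

context sparse_connected
begin

lemma total_forcing_set_iff:
  "total_forcing_set G S \<longleftrightarrow> forcing_set G S \<and> (\<forall>v\<in>S. \<exists>w\<in>S. (v, w) \<in> parcs G)"
proof -
  have "out_degree (with_proj G \<restriction> S) v \<noteq> 0 \<longleftrightarrow> (\<exists>w\<in>S. (v, w) \<in> parcs G)" if "v \<in> S" for v
  proof -
    have "out_arcs (with_proj G \<restriction> S) v = {a \<in> parcs G. fst a = v \<and> snd a \<in> S}"
      using that by (auto simp: out_arcs_def induce_subgraph_def)
    moreover have "finite {a \<in> parcs G. fst a = v \<and> snd a \<in> S}" using pair_finite_arcs by simp
    ultimately show ?thesis by (auto simp: out_degree_def)
  qed
  then show ?thesis by (auto simp: total_forcing_set_def)
qed

lemma ex_neighbor:
  assumes "v \<in> pverts G" "2 \<le> card (pverts G)"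
  obtains w where "(v, w) \<in> parcs G"
proof -
  have "{v} \<noteq> pverts G" using assms(2) by (auto dest: arg_cong[where f = card])
  then have "\<exists>w. (v, w) \<in> parcs G" using closed_eq_verts[of "{v}"] assms(1) by blast
  then show thesis using that by blast
qed

lemma total_forcing_set_verts:
  assumes "2 \<le> card (pverts G)"
  shows "total_forcing_set G (pverts G)"
  unfolding total_forcing_set_iff
proof (intro conjI ballI forcing_set_verts)
  fix v assume "v \<in> pverts G"
  then obtain w where "(v, w) \<in> parcs G" using assms by (rule ex_neighbor)
  then show "\<exists>w\<in>pverts G. (v, w) \<in> parcs G" using in_arcsD2 by blast
qed

text \<open>Record the edge of each force. Every vertex is forced at most once, vertices of
  \<open>S\<close> never, and forces at most once. A recorded edge contains a newly colored vertex,
  so it is not an edge inside \<open>S\<close>.\<close>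

lemma linear_forest_of_forcing_set:
  assumes S: "forcing_set G S"
  obtains L where "L \<subseteq> edges G" "card L + card S = card (pverts G)"
    "\<forall>v. edeg L v \<le> (if v \<in> S then 1 else 2)" "\<forall>e\<in>L. \<not> e \<subseteq> S"
proof -
  \<comment> \<open>A vertex that has forced has no uncolored neighbor left, so it never forces again.\<close>
  define open_at where "open_at A v \<longleftrightarrow> (\<exists>w. (v, w) \<in> parcs G \<and> w \<notin> A)" for A v
  \<comment> \<open>In the degree bound, the first summand pays for being forced and the second for
    forcing. The second is granted once no uncolored neighbor is left, for whatever reason.\<close>
  define I where "I A L \<longleftrightarrow> S \<subseteq> A \<and> A \<subseteq> pverts G \<and> L \<subseteq> edges G \<and> card L + card S = card A \<and>
    (\<forall>e\<in>L. e \<subseteq> A \<and> \<not> e \<subseteq> S) \<and>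
    (\<forall>v. edeg L v \<le> (if v \<in> S then 0 else 1) + (if open_at A v then 0 else 1))" for A L
  have "\<exists>L. I A L" if "(forcing_step G)\<^sup>*\<^sup>* S A" for A
    using that
  proof (induction rule: rtranclp_induct)
    case base
    have "I S {}" using S by (auto simp: I_def forcing_set_def)
    then show ?case by blast
  next
    case (step A B)
    then obtain L where L: "I A L" by blast
    obtain u v where uv: "u \<in> A" "{w. (u, w) \<in> parcs G \<and> w \<notin> A} = {v}" "B = insert v A"
      using step.hyps(2) unfolding forcing_step_def by blast
    have v: "(u, v) \<in> parcs G" "v \<notin> A" "v \<in> pverts G" using uv(2) in_arcsD2 by blast+
    have "finite L" using L finite_edges finite_subset unfolding I_def by blast
    moreover have new: "{u, v} \<notin> L" using L v(2) by (auto simp: I_def)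
    ultimately have deg: "edeg (insert {u, v} L) x = edeg L x + (if x \<in> {u, v} then 1 else 0)" for x
      by (rule edeg_insert)
    have finA: "finite A" using L pair_finite_verts finite_subset unfolding I_def by blast
    have "edeg (insert {u, v} L) x
      \<le> (if x \<in> S then 0 else 1) + (if open_at B x then 0 else 1)" for x
    proof -
      have old: "edeg L x \<le> (if x \<in> S then 0 else 1) + (if open_at A x then 0 else 1)"
        using L by (simp add: I_def)
      consider "x = u" | "x = v" "x \<noteq> u" | "x \<noteq> u" "x \<noteq> v" by blast
      then show ?thesis
      proof cases
        case 1
        have "\<not> open_at B x" using uv 1 unfolding open_at_def by blast
        moreover have "open_at A x" using v 1 unfolding open_at_def by blast
        ultimately show ?thesis using old deg[of x] 1 by simp
      next
        case 2
        have "v \<notin> \<Union>L" using L v(2) unfolding I_def by blast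
        then have "edeg L x = 0" using edeg_eq_0[OF \<open>finite L\<close>] 2 by simp
        moreover have "x \<notin> S" using L v(2) 2 unfolding I_def by blast
        ultimately show ?thesis using deg[of x] 2 by simp
      next
        case 3
        have "open_at B x \<Longrightarrow> open_at A x" using uv(3) unfolding open_at_def by blast
        then show ?thesis using old deg[of x] 3 by (auto split: if_splits)
      qed
    qed
    moreover have "card (insert {u, v} L) + card S = card B"
      using L new \<open>finite L\<close> v(2) finA uv(3) by (simp add: I_def)
    moreover have "insert {u, v} L \<subseteq> edges G" using L v(1) by (simp add: I_def in_edges_iff)
    moreover have "S \<subseteq> B" "B \<subseteq> pverts G" using L uv(3) v(3) by (auto simp: I_def)
    moreover have "\<forall>e\<in>insert {u, v} L. e \<subseteq> B \<and> \<not> e \<subseteq> S"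
      using L uv v(2) unfolding I_def by blast
    ultimately have "I B (insert {u, v} L)" unfolding I_def by blast
    then show ?case by blast
  qed
  then obtain L where L: "I (pverts G) L" using S unfolding forcing_set_def by blast
  have "edeg L v \<le> (if v \<in> S then 1 else 2)" for v
  proof -
    have "edeg L v \<le> (if v \<in> S then 0 else 1) + (if open_at (pverts G) v then 0 else 1)"
      using L unfolding I_def by blast
    then show ?thesis by (auto split: if_splits)
  qed
  then show thesis using that[of L] L unfolding I_def by blast
qed

text \<open>The linear forest of an empty forcing set would have as many edges as the graph has
  vertices.\<close>

lemma forcing_set_nonempty:
  assumes "forcing_set G S" "pverts G \<noteq> {}"
  shows "S \<noteq> {}"
proof
  assume "S = {}"
  then obtain L where L: "L \<subseteq> edges G" "card L = card (pverts G)"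
    using linear_forest_of_forcing_set[OF assms(1)] by (metis add_0_right card.empty)
  then show False
    using card_edges_less[OF assms(2)] card_mono[OF finite_edges, of L] by simp
qed

text \<open>The exchange step: vertices of \<open>S\<close> have degree at most 1 in the linear
  forest, so adding a matching inside \<open>S\<close> leaves all degrees at most 2. The enlarged
  forest is turned back into a forcing set, smaller by one vertex per added edge.\<close>

lemma forcing_set_minus_matching:
  assumes S: "forcing_set G S"
    and K: "K \<subseteq> edges G" "K \<subseteq> Pow S" "\<And>v. edeg K v \<le> 1"
  obtains S' where "forcing_set G S'" "card S' + card K = card S"
proof -
  obtain L where L: "L \<subseteq> edges G" "card L + card S = card (pverts G)"
    "\<forall>v. edeg L v \<le> (if v \<in> S then 1 else 2)" "\<forall>e\<in>L. \<not> e \<subseteq> S"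
    using linear_forest_of_forcing_set[OF S] by blast
  have fin: "finite L" "finite K" using L(1) K(1) finite_edges finite_subset by blast+
  have dis: "L \<inter> K = {}" using L(4) K(2) by blast
  have "edeg (L \<union> K) v \<le> 2" for v
  proof (cases "v \<in> S")
    case True
    then show ?thesis using L(3)[rule_format, of v] K(3)[of v] by (simp add: edeg_Un_disjoint[OF fin dis])
  next
    case False
    then have "v \<notin> \<Union>K" using K(2) by blast
    then have "edeg K v = 0" using edeg_eq_0[OF fin(2)] by blast
    then show ?thesis using L(3)[rule_format, of v] False by (simp add: edeg_Un_disjoint[OF fin dis])
  qed
  then obtain S' where S': "forcing_set G S'" "card S' + card (L \<union> K) = card (pverts G)"
    using forcing_set_of_linear_forest[of "L \<union> K"] L(1) K(1) by blast
  then have "card S' + card K = card S" using L(2) card_Un_disjoint[OF fin dis] by simp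
  with S'(1) show thesis by (rule that)
qed

section \<open>The inequality and its equality case\<close>

lemma forcing_number_less_total:
  assumes S: "total_forcing_set G S" and "pverts G \<noteq> {}"
  shows "forcing_number G + 1 \<le> card S"
proof -
  have fS: "forcing_set G S" using S by (simp add: total_forcing_set_iff)
  then obtain a b where ab: "a \<in> S" "b \<in> S" "(a, b) \<in> parcs G"
    using forcing_set_nonempty assms unfolding total_forcing_set_iff by blast
  have deg: "edeg {{a, b}} v \<le> 1" for v using edeg_insert[of "{}" "{a, b}" v] by simp
  have "{{a, b}} \<subseteq> edges G" "{{a, b}} \<subseteq> Pow S" using ab by (auto simp: in_edges_iff)
  then obtain S' where "forcing_set G S'" "card S' + card {{a, b}} = card S"
    by (rule forcing_set_minus_matching[OF fS _ _ deg])
  then show ?thesis using forcing_number_le by fastforce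
qed

text \<open>Two disjoint edges inside \<open>S\<close> would save two vertices, so any two edges
  inside \<open>S\<close> meet. Given an edge \<open>ab\<close> in \<open>S\<close>, if
  \<open>s\<close> is not adjacent to \<open>a\<close> and \<open>t\<close> is not adjacent to
  \<open>b\<close>, then \<open>bs\<close> and \<open>at\<close> are disjoint edges.\<close>

lemma minimal_total_forcing_set_star:
  assumes S: "total_forcing_set G S" "card S \<le> forcing_number G + 1" and "pverts G \<noteq> {}"
  obtains c where "c \<in> S" "\<forall>s\<in>S. s \<noteq> c \<longrightarrow> (c, s) \<in> parcs G"
proof -
  have fS: "forcing_set G S" using S by (simp add: total_forcing_set_iff)
  have meet: "{a, b} \<inter> {c, d} \<noteq> {}"
    if "(a, b) \<in> parcs G" "(c, d) \<in> parcs G" "{a, b, c, d} \<subseteq> S" for a b c d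
  proof
    assume dis: "{a, b} \<inter> {c, d} = {}"
    then have ne: "{a, b} \<notin> {{c, d}}" by auto
    have deg: "edeg {{a, b}, {c, d}} v \<le> 1" for v
      using edeg_insert[of "{{c, d}}" "{a, b}" v] edeg_insert[of "{}" "{c, d}" v] ne dis by auto
    have "{{a, b}, {c, d}} \<subseteq> edges G" "{{a, b}, {c, d}} \<subseteq> Pow S" using that by (auto simp: in_edges_iff)
    then obtain S' where "forcing_set G S'" "card S' + card {{a, b}, {c, d}} = card S"
      by (rule forcing_set_minus_matching[OF fS _ _ deg])
    then show False using forcing_number_le[of G S'] S(2) ne by simp
  qed
  obtain a b where ab: "a \<in> S" "b \<in> S" "(a, b) \<in> parcs G"
    using forcing_set_nonempty fS assms unfolding total_forcing_set_iff by blast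
  have nb: "(a, s) \<in> parcs G \<or> (b, s) \<in> parcs G" if "s \<in> S" "s \<noteq> a" "s \<noteq> b" for s
  proof -
    obtain t where "t \<in> S" "(s, t) \<in> parcs G" using S(1) \<open>s \<in> S\<close> unfolding total_forcing_set_iff by blast
    moreover from this have "t = a \<or> t = b" using meet[of a b s t] ab that by auto
    ultimately show ?thesis using arcs_symmetric by blast
  qed
  show thesis
  proof (cases "\<forall>s\<in>S. s \<noteq> a \<longrightarrow> (a, s) \<in> parcs G")
    case True
    then show ?thesis using that ab by blast
  next
    case False
    then obtain s where s: "s \<in> S" "s \<noteq> a" "(a, s) \<notin> parcs G" by blast
    then have "s \<noteq> b" "(b, s) \<in> parcs G" using ab nb by blast+
    have "(b, t) \<in> parcs G" if t: "t \<in> S" "t \<noteq> b" for t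
    proof (rule ccontr)
      assume "(b, t) \<notin> parcs G"
      then have "t \<noteq> a" "t \<noteq> s" "(a, t) \<in> parcs G"
        using t nb[of t] ab arcs_symmetric[OF ab(3)] \<open>(b, s) \<in> parcs G\<close> by auto
      then show False using meet[of b s a t] ab s t no_loops'[OF ab(3)] \<open>(b, s) \<in> parcs G\<close> by auto
    qed
    then show ?thesis using that ab by blast
  qed
qed

lemma minimal_total_forcing_set_spider:
  assumes S: "total_forcing_set G S" "card S \<le> forcing_number G + 1" and "pverts G \<noteq> {}"
  obtains c where "spider_center G c"
proof -
  obtain c where c: "c \<in> S" "\<forall>s\<in>S. s \<noteq> c \<longrightarrow> (c, s) \<in> parcs G"
    using minimal_total_forcing_set_star[OF assms] .
  have fS: "forcing_set G S" using S by (simp add: total_forcing_set_iff)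
  then have sub: "S \<subseteq> pverts G" by (simp add: forcing_set_def)
  obtain L where L: "L \<subseteq> edges G" "card L + card S = card (pverts G)"
    "\<forall>v. edeg L v \<le> (if v \<in> S then 1 else 2)" "\<forall>e\<in>L. \<not> e \<subseteq> S"
    using linear_forest_of_forcing_set[OF fS] by blast
  define K where "K = (\<lambda>s. {c, s}) ` (S - {c})"
  have K: "K \<subseteq> edges G" using c by (auto simp: K_def in_edges_iff)
  have fin: "finite L" "finite K" "finite S"
    using L(1) K sub pair_finite_verts finite_edges finite_subset by blast+
  have dis: "L \<inter> K = {}" using L(4) c(1) by (auto simp: K_def)
  have "card K = card (S - {c})"
    unfolding K_def by (rule card_image) (auto simp: inj_on_def doubleton_eq_iff)
  then have "card (L \<union> K) + 1 = card (pverts G)"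
    using L(2) c(1) fin card_Un_disjoint[OF fin(1,2) dis] card_Suc_Diff1[OF fin(3) c(1)] by simp
  \<comment> \<open>By sparsity there are at most \<open>card (pverts G) - 1\<close> edges, so
    \<open>L\<close> and the star \<open>K\<close> leave none out.\<close>
  then have "card (edges G) \<le> card (L \<union> K)" using card_edges_less[OF assms(3)] by simp
  then have all: "L \<union> K = edges G" using L(1) K finite_edges by (intro card_seteq) auto
  have "edeg (edges G) v \<le> 2" if v: "v \<noteq> c" for v
  proof -
    \<comment> \<open>The degrees from star and forest add up to at most 1 + 1 inside
      \<open>S\<close> and 0 + 2 outside.\<close>
    have "{e \<in> K. v \<in> e} = (if v \<in> S then {{c, v}} else {})" using v by (auto simp: K_def)
    then have "edeg K v = (if v \<in> S then 1 else 0)" by (simp add: edeg_def)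
    then show ?thesis using L(3)[rule_format, of v] unfolding all[symmetric] edeg_Un_disjoint[OF fin(1,2) dis]
      by (simp split: if_splits)
  qed
  then show thesis using that c(1) sub by (auto simp: spider_center_def)
qed

text \<open>The forest has \<open>card (pverts G) - card S\<close> of the at most
  \<open>card (pverts G) - 1\<close> edges. So at most \<open>card S - 1\<close> edges at
  \<open>c\<close> lie outside the forest, and at most 2 inside.\<close>

lemma degree_le_card_forcing_set:
  assumes "forcing_set G S" "pverts G \<noteq> {}"
  shows "edeg (edges G) c \<le> card S + 1"
proof -
  obtain L where L: "L \<subseteq> edges G" "card L + card S = card (pverts G)"
    "\<forall>v. edeg L v \<le> (if v \<in> S then 1 else 2)"
    by (rule linear_forest_of_forcing_set[OF assms(1)])
  have fin: "finite L" "finite (edges G - L)" using L(1) finite_edges finite_subset by blast+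
  have "L \<union> (edges G - L) = edges G" using L(1) by blast
  moreover have "edeg (L \<union> (edges G - L)) c = edeg L c + edeg (edges G - L) c"
    using fin by (rule edeg_Un_disjoint) blast
  ultimately have "edeg (edges G) c = edeg L c + edeg (edges G - L) c" by simp
  moreover have "edeg L c \<le> 2" using L(3)[rule_format, of c] by (simp split: if_splits)
  moreover have "edeg (edges G - L) c \<le> card (edges G - L)"
    unfolding edeg_def using fin by (intro card_mono) auto
  moreover have "card (edges G - L) = card (edges G) - card L" using L(1) fin by (simp add: card_Diff_subset)
  moreover have "card L \<le> card (edges G)" using L(1) finite_edges by (rule card_mono[rotated])
  ultimately show ?thesis using card_edges_less[OF assms(2)] L(2) by linarith
qed

text \<open>Color \<open>c\<close> and all its neighbors but one. First \<open>c\<close> forces the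
  missing neighbor; afterwards a colored vertex with an uncolored neighbor differs from
  \<open>c\<close>, has degree at most 2 and, by the invariant, a colored neighbor, so it can
  force.\<close>

lemma total_forcing_number_spider_le:
  assumes n: "2 \<le> card (pverts G)" and spider: "spider_center G c"
  shows "total_forcing_number G \<le> forcing_number G + 1"
proof -
  have c: "c \<in> pverts G" "\<And>v. v \<noteq> c \<Longrightarrow> edeg (edges G) v \<le> 2"
    using spider by (auto simp: spider_center_def)
  define N where "N = {w. (c, w) \<in> parcs G}"
  have N: "finite N" "card N = edeg (edges G) c" "c \<notin> N" "N \<subseteq> pverts G"
    using finite_neighbors no_loops' in_arcsD2 by (auto simp: N_def edeg_edges)
  obtain w where w: "w \<in> N" using ex_neighbor[OF c(1) n] by (auto simp: N_def)
  \<comment> \<open>If \<open>c\<close> is a leaf, omitting its only neighbor would leave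
    \<open>c\<close> isolated in \<open>S\<close>.\<close>
  define S where "S = (if N = {w} then {c, w} else insert c (N - {w}))"
  have S: "S \<subseteq> insert c N" "c \<in> S" "N - S \<subseteq> {w}" "\<exists>s\<in>N. s \<in> S" using w by (auto simp: S_def)
  have total: "\<forall>v\<in>S. \<exists>u\<in>S. (v, u) \<in> parcs G"
  proof
    fix v assume "v \<in> S"
    then consider "v = c" | "(c, v) \<in> parcs G" using S(1) by (auto simp: N_def)
    then show "\<exists>u\<in>S. (v, u) \<in> parcs G"
      using S(2,4) arcs_symmetric by cases (auto simp: N_def)
  qed
  have "forcing_set G S"
  proof (rule forcing_setI[where P = "\<lambda>A. S \<subseteq> A \<and> (\<forall>v\<in>A. \<exists>u\<in>A. (v, u) \<in> parcs G)"])
    fix A assume A: "S \<subseteq> A \<and> (\<forall>v\<in>A. \<exists>u\<in>A. (v, u) \<in> parcs G)" "A \<subset> pverts G"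
    have "\<exists>x\<in>A. \<exists>y. {w. (x, w) \<in> parcs G \<and> w \<notin> A} = {y}"
    proof (cases "N \<subseteq> A")
      case False
      then have "{u. (c, u) \<in> parcs G \<and> u \<notin> A} = {w}" using A S by (auto simp: N_def)
      then show ?thesis using A S by blast
    next
      case True
      obtain x y where xy: "x \<in> A" "(x, y) \<in> parcs G" "y \<notin> A"
        using closed_eq_verts[of A] A S by blast
      obtain z where z: "z \<in> A" "(x, z) \<in> parcs G" using A xy by blast
      have "x \<noteq> c" using True xy by (auto simp: N_def)
      then have "card {u. (x, u) \<in> parcs G} \<le> 2" using c(2)[of x] by (simp add: edeg_edges)
      moreover have "y \<noteq> z" using xy(3) z(1) by blast
      then have "card {y, z} = 2" by simp
      ultimately have "{y, z} = {u. (x, u) \<in> parcs G}"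
        using xy z finite_neighbors by (intro card_seteq) auto
      then have "{u. (x, u) \<in> parcs G \<and> u \<notin> A} = {y}" using xy z by auto
      then show ?thesis using xy by blast
    qed
    then obtain x y where xy: "x \<in> A" "{w. (x, w) \<in> parcs G \<and> w \<notin> A} = {y}" by blast
    then have "(x, y) \<in> parcs G" by blast
    then have "y \<in> pverts G" "S \<subseteq> insert y A \<and> (\<forall>v\<in>insert y A. \<exists>u\<in>insert y A. (v, u) \<in> parcs G)"
      using A(1) xy(1) in_arcsD2 arcs_symmetric by blast+
    then show "\<exists>x\<in>A. \<exists>y\<in>pverts G. {w. (x, w) \<in> parcs G \<and> w \<notin> A} = {y} \<and>
        S \<subseteq> insert y A \<and> (\<forall>v\<in>insert y A. \<exists>u\<in>insert y A. (v, u) \<in> parcs G)"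
      using xy by blast
  qed (use S N c total pair_finite_verts in auto)
  then have "total_forcing_number G \<le> card S"
    using total by (intro total_forcing_number_le) (simp add: total_forcing_set_iff)
  \<comment> \<open>The value 2 covers the case of a leaf \<open>c\<close>; it is at most
    \<open>forcing_number G + 1\<close> because a forcing set is nonempty.\<close>
  moreover have "card S \<le> max 2 (edeg (edges G) c)"
  proof (cases "N = {w}")
    case False
    then have "card S = Suc (card (N - {w}))" using N by (simp add: S_def)
    then show ?thesis using N(2) card_Suc_Diff1[OF N(1) w] by simp
  next
    case True
    then have "card S \<le> Suc (Suc 0)" by (simp add: S_def card_insert_if)
    then show ?thesis by linarith
  qed
  moreover have ne: "pverts G \<noteq> {}" using c by blast
  obtain S' where S': "forcing_set G S'" "card S' = forcing_number G"
    using forcing_number_attained[OF forcing_set_verts] .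
  have "finite S'" using S' pair_finite_verts finite_subset unfolding forcing_set_def by blast
  then have "1 \<le> forcing_number G"
    using forcing_set_nonempty[OF S'(1) ne] S'(2) by (metis card_gt_0_iff Suc_leI One_nat_def)
  moreover have "edeg (edges G) c \<le> forcing_number G + 1"
    using degree_le_card_forcing_set[OF S'(1) ne] S'(2) by simp
  ultimately show ?thesis by linarith
qed

lemma total_forcing_number_bounds:
  assumes n: "2 \<le> card (pverts G)"
  shows "forcing_number G + 1 \<le> total_forcing_number G"
    and "total_forcing_number G = forcing_number G + 1 \<longleftrightarrow> (\<exists>c. spider_center G c)"
proof -
  have ne: "pverts G \<noteq> {}" using n by auto
  obtain S where S: "total_forcing_set G S" "card S = total_forcing_number G"
    using total_forcing_number_attained[OF total_forcing_set_verts[OF n]] .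
  show lower: "forcing_number G + 1 \<le> total_forcing_number G"
    using forcing_number_less_total[OF S(1) ne] S(2) by simp
  show "total_forcing_number G = forcing_number G + 1 \<longleftrightarrow> (\<exists>c. spider_center G c)"
    using minimal_total_forcing_set_spider[OF S(1) _ ne] S(2)
      total_forcing_number_spider_le[OF n] lower by (metis le_antisym order_refl)
qed

end

section \<open>Paths and contractions\<close>

context sparse_connected
begin

text \<open>Take a maximal path. Its ends have all neighbors on it by maximality, its inner vertices
  because their two path neighbors exhaust the degree. So its vertex set is closed, hence
  everything.\<close>

lemma path_of_max_degree_2:
  assumes deg: "\<And>v. edeg (edges G) v \<le> 2" and "pverts G \<noteq> {}"
  obtains p where "distinct p" "set p = pverts G"
    "\<forall>i<length p. \<forall>j<length p. (p ! i, p ! j) \<in> parcs G \<longleftrightarrow> j = Suc i \<or> i = Suc j"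
proof -
  obtain v where "v \<in> pverts G" using assms(2) by blast
  from maximal_path_exists[OF pair_finite_verts this, of "\<lambda>u v. (u, v) \<in> parcs G"]
  obtain p where p: "p \<noteq> []" "distinct p" "set p \<subseteq> pverts G" "successively (\<lambda>u v. (u, v) \<in> parcs G) p"
    and max: "\<And>y. y \<in> pverts G \<Longrightarrow> (y, hd p) \<in> parcs G \<Longrightarrow> y \<in> set p"
      "\<And>y. y \<in> pverts G \<Longrightarrow> (last p, y) \<in> parcs G \<Longrightarrow> y \<in> set p" by metis
  have arc: "(p ! i, p ! Suc i) \<in> parcs G" if "Suc i < length p" for i
    using p(4) that by (simp add: successively_conv_nth)
  have "v \<in> set p" if u: "u \<in> set p" and uv: "(u, v) \<in> parcs G" for u v
  proof -
    obtain i where i: "i < length p" "p ! i = u" using u by (auto simp: in_set_conv_nth)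
    consider "i = 0" | "Suc i = length p" | j where "i = Suc j" "Suc i < length p"
      using i(1) by (metis Suc_lessI not0_implies_Suc)
    then show "v \<in> set p"
    proof cases
      case 1
      then have "hd p = u" using i p(1) by (simp add: hd_conv_nth)
      then show ?thesis using max(1) uv arcs_symmetric in_arcsD2 by blast
    next
      case 2
      then have "last p = u" using i p(1) by (simp add: last_conv_nth flip: 2)
      then show ?thesis using max(2) uv in_arcsD2 by blast
    next
      case 3
      have "(u, p ! j) \<in> parcs G" using arc[of j] 3 i arcs_symmetric by auto
      moreover have "(u, p ! Suc i) \<in> parcs G" using arc[of i] 3 i by auto
      moreover have "card {p ! j, p ! Suc i} = 2" using p(2) 3 by (simp add: nth_eq_iff_index_eq)
      moreover have "card {y. (u, y) \<in> parcs G} \<le> 2" using deg[of u] by (simp add: edeg_edges)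
      ultimately have "{p ! j, p ! Suc i} = {y. (u, y) \<in> parcs G}"
        using finite_neighbors by (intro card_seteq) auto
      then have "v \<in> {p ! j, p ! Suc i}" using uv by blast
      then show ?thesis using 3 by auto
    qed
  qed
  then have set_p: "set p = pverts G" using closed_eq_verts[of "set p"] p(1,3) by blast
  \<comment> \<open>The consecutive pairs already number one less than the vertices, so they are all
    the edges and the path has no chord.\<close>
  define C where "C = (\<lambda>i. {p ! i, p ! Suc i}) ` {..<length p - 1}"
  have "C \<subseteq> edges G" using arc by (auto simp: C_def in_edges_iff)
  moreover have "inj_on (\<lambda>i. {p ! i, p ! Suc i}) {..<length p - 1}"
    using p(2) by (auto simp: inj_on_def doubleton_eq_iff nth_eq_iff_index_eq)
  then have "card C + 1 = card (pverts G)"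
    using p(1) distinct_card[OF p(2)] set_p by (simp add: C_def card_image)
  then have "card (edges G) \<le> card C" using card_edges_less[OF assms(2)] by simp
  ultimately have C: "C = edges G" using finite_edges by (intro card_seteq)
  have "(p ! i, p ! j) \<in> parcs G \<longleftrightarrow> j = Suc i \<or> i = Suc j" if ij: "i < length p" "j < length p" for i j
  proof
    assume "(p ! i, p ! j) \<in> parcs G"
    then have "{p ! i, p ! j} \<in> C" by (simp add: C in_edges_iff)
    then show "j = Suc i \<or> i = Suc j"
      using p(2) ij by (auto simp: C_def doubleton_eq_iff nth_eq_iff_index_eq)
  next
    assume "j = Suc i \<or> i = Suc j"
    then show "(p ! i, p ! j) \<in> parcs G" using arc ij arcs_symmetric by blast
  qed
  then show thesis using that p(2) set_p by blast
qed

lemma iso_path_graph: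
  assumes "\<And>v. edeg (edges G) v \<le> 2" "pverts G \<noteq> {}"
  shows "digraph_iso (with_proj G) (with_proj (path_graph (card (pverts G))))"
proof -
  obtain p where p: "distinct p" "set p = pverts G"
    "\<forall>i<length p. \<forall>j<length p. (p ! i, p ! j) \<in> parcs G \<longleftrightarrow> j = Suc i \<or> i = Suc j"
    using path_of_max_degree_2[OF assms] by blast
  define n where "n = card (pverts G)"
  have n: "n = length p" using distinct_card[OF p(1)] p(2) by (simp add: n_def)
  interpret P: pair_wf_digraph "path_graph n"
    by unfold_locales (auto simp: path_graph_def)
  \<comment> \<open>Indexing into \<open>p\<close> gives an isomorphism from
    \<open>path_graph n\<close> onto \<open>G\<close>; it is inverted at the end.\<close>
  define h where "h = \<lparr>iso_verts = (!) p, iso_arcs = map_prod ((!) p) ((!) p), iso_head = snd, iso_tail = fst\<rparr>"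
  have inj: "inj_on ((!) p) {..<n}" using p(1) by (simp add: inj_on_nth n)
  have "inj_on (map_prod ((!) p) ((!) p)) ({..<n} \<times> {..<n})" using inj by (intro map_prod_inj_on)
  then have "inj_on (map_prod ((!) p) ((!) p)) (parcs (path_graph n))"
    by (rule inj_on_subset) (auto simp: path_graph_def)
  then have hom: "P.digraph_isomorphism h"
    unfolding P.digraph_isomorphism_def using inj P.wf_digraph_axioms
    by (intro conjI) (auto simp: h_def path_graph_def)
  have "(!) p ` {..<n} = pverts G" using p(2) by (auto simp: n in_set_conv_nth set_conv_nth)
  moreover have "map_prod ((!) p) ((!) p) ` parcs (path_graph n) = parcs G"
  proof (intro equalityI subsetI)
    fix a assume "a \<in> parcs G"
    moreover obtain u v where "a = (u, v)" by (cases a)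
    moreover obtain i j where "i < length p" "j < length p" "p ! i = u" "p ! j = v"
      using calculation in_arcsD1[of u v] in_arcsD2[of u v] p(2) by (metis in_set_conv_nth)
    ultimately show "a \<in> map_prod ((!) p) ((!) p) ` parcs (path_graph n)"
      using p(3) by (intro image_eqI[of _ _ "(i, j)"]) (auto simp: path_graph_def n)
  qed (use p(3) in \<open>auto simp: path_graph_def n\<close>)
  ultimately have "app_iso h (with_proj (path_graph n)) = with_proj G"
    by (simp add: app_iso_def h_def with_proj_def) (simp add: path_graph_def)
  then show ?thesis
    using P.digraph_isomorphism_invI[OF hom] P.app_iso_inv[OF hom]
    unfolding digraph_iso_def n_def[symmetric] by metis
qed

lemma iso_path_graph_max_degree:
  assumes "digraph_iso (with_proj G) (with_proj (path_graph n))" "v \<in> pverts G"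
  shows "edeg (edges G) v \<le> 2"
proof -
  obtain f where f: "digraph_isomorphism f" "with_proj (path_graph n) = app_iso f (with_proj G)"
    using assms(1) unfolding digraph_iso_def by blast
  have "out_degree (with_proj G) v = out_degree (with_proj (path_graph n)) (iso_verts f v)"
    using out_degree_app_iso_eq[OF f(1)] assms(2) f(2) by simp
  also have "out_degree (with_proj (path_graph n)) i \<le> 2" for i
  proof -
    \<comment> \<open>For \<open>i = 0\<close> the truncated \<open>i - 1\<close> yields the pair
      \<open>(0, 0)\<close>, harmless in an upper bound.\<close>
    have "out_arcs (with_proj (path_graph n)) i \<subseteq> {(i, Suc i), (i, i - 1)}"
      by (auto simp: out_arcs_def path_graph_def)
    then have "out_degree (with_proj (path_graph n)) i \<le> card {(i, Suc i), (i, i - 1)}"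
      unfolding out_degree_def by (intro card_mono) auto
    also have "\<dots> \<le> 2" by (simp add: card_insert_if)
    finally show ?thesis .
  qed
  finally show ?thesis by (simp add: out_degree_eq)
qed

text \<open>Three edges would cover only three vertices. This keeps distinct neighbors of a third
  vertex from being merged by a contraction.\<close>

lemma triangle_free:
  assumes "(x, y) \<in> parcs G" "(v, x) \<in> parcs G" "(v, y) \<in> parcs G"
  shows False
proof -
  have ne: "x \<noteq> y" "v \<noteq> x" "v \<noteq> y" using assms no_loops' by blast+
  have "{{x, y}, {v, x}, {v, y}} \<subseteq> edges G" using assms by (simp add: in_edges_iff)
  then have "card {{x, y}, {v, x}, {v, y}} < card (\<Union>{{x, y}, {v, x}, {v, y}})" by (rule sparse) simp
  moreover have "\<Union>{{x, y}, {v, x}, {v, y}} = {x, y, v}" by auto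
  ultimately show False using ne by (simp add: doubleton_eq_iff)
qed

section \<open>Contraction of an edge\<close>

context
  fixes x y and r :: "'a \<Rightarrow> 'a"
  assumes xy: "(x, y) \<in> parcs G"
  defines "r \<equiv> \<lambda>v. if v = y then x else v"
begin

lemma contract_edge_arc_iff:
  "(a, b) \<in> parcs (contract_edge G x y) \<longleftrightarrow> (\<exists>u v. (u, v) \<in> parcs G \<and> a = r u \<and> b = r v \<and> a \<noteq> b)"
  by (auto simp: contract_edge_def r_def Let_def)

lemma pverts_contract_edge: "pverts (contract_edge G x y) = pverts G - {y}"
  using in_arcsD1[OF xy] no_loops'[OF xy] by (auto simp: contract_edge_def Let_def)

lemma pair_graph_contract_edge: "pair_graph (contract_edge G x y)"
proof
  let ?H = "contract_edge G x y"
  have arc: "fst e \<in> pverts ?H \<and> snd e \<in> pverts ?H \<and> fst e \<noteq> snd e \<and> (snd e, fst e) \<in> parcs ?H"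
    if e_arc: "e \<in> parcs ?H" for e
  proof -
    obtain a b where e: "e = (a, b)" by (cases e)
    then obtain u v where uv: "(u, v) \<in> parcs G" "a = r u" "b = r v" "a \<noteq> b"
      using e_arc contract_edge_arc_iff[of a b] by blast
    then have "(b, a) \<in> parcs ?H" using contract_edge_arc_iff arcs_symmetric by metis
    moreover have "a \<in> pverts ?H" "b \<in> pverts ?H"
      using in_arcsD1[OF uv(1)] in_arcsD2[OF uv(1)] uv in_arcsD1[OF xy] no_loops'[OF xy]
      by (auto simp: pverts_contract_edge r_def)
    ultimately show ?thesis using e uv(4) by simp
  qed
  show "fst e \<in> pverts ?H" "snd e \<in> pverts ?H" "fst e \<noteq> snd e" if "e \<in> parcs ?H" for e
    using arc[OF that] by auto
  show fin: "finite (pverts ?H)" by (simp add: pverts_contract_edge pair_finite_verts)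
  have "parcs ?H \<subseteq> pverts ?H \<times> pverts ?H" using arc by force
  then show "finite (parcs ?H)" using fin finite_subset by blast
  show "symmetric (with_proj ?H)" using arc by (force simp: symmetric_def intro: symI)
qed

text \<open>Every edge of the contracted graph is the image under \<open>r\<close> of an edge of
  \<open>G\<close>, so sparsity is tested on lifted edges. For connectedness, the preimage of a
  closed set under \<open>r\<close> is closed in \<open>G\<close>.\<close>

lemma sparse_connected_contract_edge: "sparse_connected (contract_edge G x y)"
proof -
  let ?H = "contract_edge G x y"
  interpret H: pair_graph ?H by (rule pair_graph_contract_edge)
  show ?thesis
  proof
    fix F assume F: "F \<subseteq> edges ?H" "F \<noteq> {}"
    have "\<exists>d. d \<in> edges G \<and> r ` d = e" if eF: "e \<in> F" for e
    proof -
      obtain a b where ab: "e = {a, b}" "(a, b) \<in> parcs ?H" using subsetD[OF F(1) eF] by (rule H.edgesE) blast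
      then obtain u v where "(u, v) \<in> parcs G" "a = r u" "b = r v"
        using contract_edge_arc_iff by blast
      then show ?thesis using ab(1) by (intro exI[of _ "{u, v}"]) (simp add: in_edges_iff)
    qed
    then obtain h where h: "\<And>e. e \<in> F \<Longrightarrow> h e \<in> edges G \<and> r ` h e = e" by metis
    have finF: "finite F" using F(1) H.finite_edges finite_subset by blast
    have finU: "finite (\<Union>F)"
      using F(1) H.Union_edges_subset H.pair_finite_verts by (meson Union_mono finite_subset)
    show "card F < card (\<Union>F)"
    proof (cases "x \<in> \<Union>F")
      case False
      have "h e = e" if "e \<in> F" for e
      proof -
        have "r ` h e = e" using h[OF that] by simp
        moreover from this have "y \<notin> h e" using False that by (auto simp: r_def)
        ultimately show ?thesis by (auto simp: r_def)
      qed
      then have "F \<subseteq> edges G" using h by force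
      then show ?thesis using F(2) by (rule sparse)
    next
      case True
      \<comment> \<open>Undoing the contraction adds the edge \<open>xy\<close> but only one new vertex.\<close>
      define F' where "F' = insert {x, y} (h ` F)"
      have "{x, y} \<notin> h ` F"
      proof
        assume "{x, y} \<in> h ` F"
        then obtain e where e: "e \<in> F" "h e = {x, y}" by auto
        moreover have "r ` {x, y} = {x}" by (auto simp: r_def)
        ultimately have "e = {x}" using h[OF e(1)] by simp
        then show False using H.card_edge[of e] F(1) e(1) by auto
      qed
      moreover have "inj_on h F" using h by (intro inj_on_inverseI[of F "(`) r"]) blast
      ultimately have "card F' = card F + 1" using finF by (simp add: F'_def card_image)
      moreover have "F' \<subseteq> edges G" using h xy by (auto simp: F'_def in_edges_iff)
      ultimately have less: "card F + 1 < card (\<Union>F')" using sparse[of F'] by (simp add: F'_def)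
      have "v \<in> insert y (\<Union>F)" if v: "v \<in> h e" "e \<in> F" for v e
      proof -
        have "r v \<in> e" using h[OF v(2)] v(1) by blast
        then show ?thesis using v(2) by (auto simp: r_def split: if_splits)
      qed
      then have "\<Union>F' \<subseteq> insert y (\<Union>F)" using True by (auto simp: F'_def)
      then have "card (\<Union>F') \<le> card (insert y (\<Union>F))" using finU by (intro card_mono) auto
      also have "\<dots> \<le> card (\<Union>F) + 1" using finU by (simp add: card_insert_if)
      finally show ?thesis using less by linarith
    qed
  next
    fix X assume X: "X \<subseteq> pverts ?H" "X \<noteq> {}"
      and closed: "\<And>u v. u \<in> X \<Longrightarrow> (u, v) \<in> parcs ?H \<Longrightarrow> v \<in> X"
    have fixed: "r v = v" if "v \<in> pverts ?H" for v using that by (simp add: r_def pverts_contract_edge)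
    define Y where "Y = {v \<in> pverts G. r v \<in> X}"
    have Y: "Y = pverts G"
    proof (rule closed_eq_verts)
      obtain v where v: "v \<in> X" using X(2) by blast
      then have "v \<in> pverts ?H" using X(1) by blast
      then have "v \<in> Y" using v fixed[of v] by (simp add: Y_def pverts_contract_edge)
      then show "Y \<noteq> {}" by blast
    next
      fix u v assume uv: "u \<in> Y" "(u, v) \<in> parcs G"
      have "r v \<in> X"
      proof (cases "r u = r v")
        case True
        then show ?thesis using uv(1) by (simp add: Y_def)
      next
        case False
        then have "(r u, r v) \<in> parcs ?H" using uv(2) contract_edge_arc_iff by blast
        then show ?thesis using closed uv(1) by (auto simp: Y_def)
      qed
      then show "v \<in> Y" using in_arcsD2[OF uv(2)] by (simp add: Y_def)
    qed (auto simp: Y_def)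
    have "v \<in> X" if v: "v \<in> pverts ?H" for v
    proof -
      have "v \<in> Y" using v by (simp add: Y pverts_contract_edge)
      then show ?thesis using fixed[OF v] by (simp add: Y_def)
    qed
    then show "X = pverts ?H" using X(1) by blast
  qed
qed

text \<open>As there are no triangles, \<open>v\<close> is not adjacent to both \<open>x\<close> and
  \<open>y\<close>, so \<open>r\<close> is injective on its neighbors.\<close>

lemma degree_contract_edge_other:
  assumes "v \<noteq> x" "v \<noteq> y"
  shows "edeg (edges (contract_edge G x y)) v = edeg (edges G) v"
proof -
  interpret H: pair_graph "contract_edge G x y" by (rule pair_graph_contract_edge)
  have "{w. (v, w) \<in> parcs (contract_edge G x y)} = r ` {w. (v, w) \<in> parcs G}"
  proof (intro equalityI subsetI)
    fix w assume "w \<in> {w. (v, w) \<in> parcs (contract_edge G x y)}"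
    then obtain u z where uz: "(u, z) \<in> parcs G" "v = r u" "w = r z" using contract_edge_arc_iff by blast
    then have "u = v" using assms by (auto simp: r_def split: if_splits)
    then show "w \<in> r ` {w. (v, w) \<in> parcs G}" using uz by blast
  next
    fix w assume "w \<in> r ` {w. (v, w) \<in> parcs G}"
    then obtain z where z: "(v, z) \<in> parcs G" "w = r z" by blast
    moreover have "r v = v" using assms by (simp add: r_def)
    moreover have "v \<noteq> w" using z no_loops'[OF z(1)] assms by (auto simp: r_def)
    ultimately have "(v, w) \<in> parcs (contract_edge G x y)"
      unfolding contract_edge_arc_iff by (intro exI[of _ v] exI[of _ z]) simp
    then show "w \<in> {w. (v, w) \<in> parcs (contract_edge G x y)}" by simp
  qed
  moreover have "inj_on r {w. (v, w) \<in> parcs G}"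
  proof (rule inj_onI)
    fix a b assume "a \<in> {w. (v, w) \<in> parcs G}" "b \<in> {w. (v, w) \<in> parcs G}" "r a = r b"
    moreover have "\<not> ((v, x) \<in> parcs G \<and> (v, y) \<in> parcs G)" using triangle_free[OF xy] by blast
    ultimately show "a = b" by (auto simp: r_def split: if_splits)
  qed
  ultimately show ?thesis unfolding edeg_edges H.edeg_edges by (simp add: card_image)
qed

text \<open>Each end loses the other as a neighbor; the \<open>+ 2\<close> on the left avoids
  truncated subtraction. For a trimmable edge the merged vertex has degree at most 2.\<close>

lemma degree_contract_edge_merged:
  "edeg (edges (contract_edge G x y)) x + 2 \<le> edeg (edges G) x + edeg (edges G) y"
proof -
  interpret H: pair_graph "contract_edge G x y" by (rule pair_graph_contract_edge)
  let ?N = "\<lambda>v. {w. (v, w) \<in> parcs G}"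
  have "{w. (x, w) \<in> parcs (contract_edge G x y)} \<subseteq> (?N x - {y}) \<union> (?N y - {x})"
  proof
    fix w assume "w \<in> {w. (x, w) \<in> parcs (contract_edge G x y)}"
    then obtain u z where uz: "(u, z) \<in> parcs G" "x = r u" "w = r z" "x \<noteq> w"
      using contract_edge_arc_iff by blast
    then have "z = w" "z \<noteq> x" "z \<noteq> y" by (auto simp: r_def split: if_splits)
    moreover have "u = x \<or> u = y" using uz(2) by (auto simp: r_def split: if_splits)
    ultimately show "w \<in> (?N x - {y}) \<union> (?N y - {x})" using uz(1) by blast
  qed
  then have "card {w. (x, w) \<in> parcs (contract_edge G x y)} \<le> card ((?N x - {y}) \<union> (?N y - {x}))"
    using finite_neighbors by (intro card_mono) auto
  also have "\<dots> \<le> card (?N x - {y}) + card (?N y - {x})" by (rule card_Un_le)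
  finally have "card {w. (x, w) \<in> parcs (contract_edge G x y)} \<le> card (?N x - {y}) + card (?N y - {x})" .
  moreover have "Suc (card (?N x - {y})) = card (?N x)" "Suc (card (?N y - {x})) = card (?N y)"
    using xy arcs_symmetric finite_neighbors by (intro card_Suc_Diff1; simp)+
  ultimately show ?thesis by (simp add: edeg_edges H.edeg_edges)
qed

end

end

section \<open>The extremal trees\<close>

context sparse_connected
begin

text \<open>Both ends of a trimmable edge and the merged vertex have degree at most 2, and all other
  degrees stay the same, so a spider center can be followed through the contraction. A center of
  degree at least 3 is not an end of the edge.\<close>

lemma trim_step_facts:
  assumes "trim_step G H"
  shows "sparse_connected H"
    and "spider_center H c \<Longrightarrow> spider_center G c"
    and "spider_center G c \<Longrightarrow> 3 \<le> edeg (edges G) c \<Longrightarrow>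
      spider_center H c \<and> edeg (edges H) c = edeg (edges G) c"
    and "card (pverts H) < card (pverts G)"
proof -
  obtain x y where xy: "(x, y) \<in> parcs G" "edeg (edges G) x = 2" "edeg (edges G) y \<le> 2"
    and H: "H = contract_edge G x y"
    using assms unfolding trim_step_def trimmable_edge_def out_degree_eq by blast
  have deg: "edeg (edges H) v = edeg (edges G) v" if "v \<noteq> x" "v \<noteq> y" for v
    unfolding H using xy(1) that by (rule degree_contract_edge_other)
  have degx: "edeg (edges H) x \<le> 2"
    using degree_contract_edge_merged[OF xy(1)] xy(2,3) unfolding H by linarith
  have verts: "pverts H = pverts G - {y}" unfolding H using xy(1) by (rule pverts_contract_edge)
  show sc: "sparse_connected H" unfolding H using xy(1) by (rule sparse_connected_contract_edge)
  interpret H: sparse_connected H by (rule sc)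
  \<comment> \<open>\<open>spider_center\<close> bounds \<open>edeg\<close> at every element of the
    type, so the vanished \<open>y\<close> has to be covered too.\<close>
  have "y \<notin> \<Union>(edges H)" using H.Union_edges_subset verts by blast
  then have degy: "edeg (edges H) y = 0" using edeg_eq_0[OF H.finite_edges] by blast
  show "spider_center G c" if c: "spider_center H c"
  proof -
    have "edeg (edges G) v \<le> 2" if "v \<noteq> c" for v
      using deg[of v] xy(2,3) c that unfolding spider_center_def by (metis order_refl)
    then show ?thesis using c verts by (auto simp: spider_center_def)
  qed
  show "spider_center H c \<and> edeg (edges H) c = edeg (edges G) c"
    if c: "spider_center G c" "3 \<le> edeg (edges G) c"
  proof -
    have "c \<noteq> x" "c \<noteq> y" using c(2) xy(2,3) by auto
    moreover have "edeg (edges H) v \<le> 2" if "v \<noteq> c" for v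
      using deg[of v] degx degy c(1) that unfolding spider_center_def by (metis zero_le)
    ultimately show ?thesis using c(1) verts deg[of c] by (auto simp: spider_center_def)
  qed
  show "card (pverts H) < card (pverts G)"
    unfolding verts using in_arcsD2[OF xy(1)] pair_finite_verts by (rule card_Diff1_less[rotated])
qed

lemma trim_steps_facts:
  assumes "trim_step\<^sup>*\<^sup>* G H"
  shows "sparse_connected H \<and> (\<forall>c. spider_center H c \<longrightarrow> spider_center G c)"
  using assms
proof (induction rule: rtranclp_induct)
  case base
  then show ?case using sparse_connected_axioms by blast
next
  case (step A B)
  then interpret A: sparse_connected A by blast
  show ?case using A.trim_step_facts(1,2)[OF step.hyps(2)] step.IH by blast
qed

text \<open>Suppose \<open>v\<close> and \<open>w\<close> are adjacent and both differ from
  \<open>c\<close>. Neither has degree 2, as the edge would be trimmable, so both are leaves; then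
  the two of them form a closed set avoiding \<open>c\<close>. Hence every edge contains
  \<open>c\<close>.\<close>

lemma trimmed_spider_star:
  assumes c: "spider_center G c" "3 \<le> edeg (edges G) c"
    and trimmed: "\<not> (\<exists>x y. trimmable_edge G x y)"
  shows "complete_bipartite_digraph 1 (edeg (edges G) c) (with_proj G)"
proof -
  define N where "N = {w. (c, w) \<in> parcs G}"
  have deg2: "edeg (edges G) v \<le> 2" if "v \<noteq> c" for v
    using c(1) that by (auto simp: spider_center_def)
  have only: "w = c" if vw: "v \<noteq> c" "(v, w) \<in> parcs G" for v w
  proof (rule ccontr)
    assume "w \<noteq> c"
    have single: "{z. (a, z) \<in> parcs G} = {b}" if ab: "(a, b) \<in> parcs G" "a \<noteq> c" "b \<noteq> c" for a b
    proof -
      have "edeg (edges G) a \<noteq> 2"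
        using trimmed ab deg2[of b] unfolding trimmable_edge_def out_degree_eq by blast
      then have "card {z. (a, z) \<in> parcs G} \<le> card {b}" using deg2[of a] ab(2) by (simp add: edeg_edges)
      then have "{b} = {z. (a, z) \<in> parcs G}"
        using ab(1) finite_neighbors by (intro card_seteq) auto
      then show ?thesis by simp
    qed
    have "{z. (v, z) \<in> parcs G} = {w}" "{z. (w, z) \<in> parcs G} = {v}"
      using single[of v w] single[of w v] vw \<open>w \<noteq> c\<close> arcs_symmetric by blast+
    then have "{v, w} = pverts G"
      using in_arcsD1[OF vw(2)] in_arcsD2[OF vw(2)] by (intro closed_eq_verts) auto
    then show False using c(1) vw(1) \<open>w \<noteq> c\<close> by (auto simp: spider_center_def)
  qed
  have "c \<in> pverts G" using c(1) by (simp add: spider_center_def)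
  have "N \<subseteq> pverts G" "c \<notin> N" using in_arcsD2 no_loops' by (auto simp: N_def)
  have verts: "insert c N = pverts G"
  proof (intro closed_eq_verts)
    fix u v assume "u \<in> insert c N" "(u, v) \<in> parcs G"
    then show "v \<in> insert c N" using only[of u v] by (cases "u = c") (auto simp: N_def)
  qed (use \<open>c \<in> pverts G\<close> \<open>N \<subseteq> pverts G\<close> in auto)
  have "a \<in> {c} \<times> N \<union> N \<times> {c}" if a: "a \<in> parcs G" for a
  proof -
    obtain u v where uv: "a = (u, v)" by (cases a)
    have "(u, v) \<in> parcs G" "(v, u) \<in> parcs G" using a arcs_symmetric[of u v] by (simp_all add: uv)
    then show ?thesis using uv only[of u v] by (cases "u = c") (auto simp: N_def)
  qed
  moreover have "{c} \<times> N \<union> N \<times> {c} \<subseteq> parcs G"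
    unfolding N_def by (auto intro: arcs_symmetric)
  ultimately have "parcs G = {c} \<times> N \<union> N \<times> {c}" by blast
  moreover have "card N = edeg (edges G) c" by (simp add: N_def edeg_edges)
  ultimately show ?thesis
    unfolding complete_bipartite_digraph_pair_def using verts \<open>c \<notin> N\<close> pair_finite_verts
    by (intro conjI exI[of _ "{c}"] exI[of _ N]) simp_all
qed

text \<open>Trimming ends because each contraction removes a vertex, and the center keeps its degree
  throughout.\<close>

lemma spider_trims_to_star:
  assumes "spider_center G c" "3 \<le> edeg (edges G) c"
  shows "\<exists>H k. is_trim G H \<and> 3 \<le> k \<and> complete_bipartite_digraph 1 k (with_proj H)"
  using assms sparse_connected_axioms
proof (induction "card (pverts G)" arbitrary: G rule: less_induct)
  case less
  interpret L: sparse_connected G by (rule less.prems)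
  show ?case
  proof (cases "\<exists>x y. trimmable_edge G x y")
    case True
    then obtain H where H: "trim_step G H" unfolding trim_step_def by blast
    note facts = L.trim_step_facts[OF H]
    have "spider_center H c" "3 \<le> edeg (edges H) c" using facts(3)[of c] less.prems(1,2) by auto
    then obtain K k where "is_trim H K" "3 \<le> k" "complete_bipartite_digraph 1 k (with_proj K)"
      using less.hyps[OF facts(4)] facts(1) by blast
    moreover from this have "is_trim G K"
      using H unfolding is_trim_def by (blast intro: converse_rtranclp_into_rtranclp)
    ultimately show ?thesis by blast
  next
    case False
    then have "is_trim G G" by (simp add: is_trim_def)
    then show ?thesis using L.trimmed_spider_star[OF less.prems(1,2) False] less.prems(2) by blast
  qed
qed

end

lemma star_spider_center:
  assumes "complete_bipartite_digraph 1 k (with_proj G)"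
  shows "\<exists>c. spider_center G c"
proof -
  interpret pair_graph G using assms by (rule pair_graphI_complete_bipartite)
  obtain U V where UV: "pverts G = U \<union> V" "U \<inter> V = {}" "card U = 1" "parcs G = U \<times> V \<union> V \<times> U"
    using assms unfolding complete_bipartite_digraph_pair_def by blast
  then obtain c where c: "U = {c}" by (auto simp: card_1_singleton_iff)
  have "edeg (edges G) v \<le> 2" if "v \<noteq> c" for v
  proof -
    have "{w. (v, w) \<in> parcs G} \<subseteq> {c}" using UV(4) c that by auto
    then have "card {w. (v, w) \<in> parcs G} \<le> card {c}" by (intro card_mono) auto
    then show ?thesis by (simp add: edeg_edges)
  qed
  then show ?thesis using UV(1) c by (auto simp: spider_center_def)
qed

text \<open>A center of degree at least 3 survives trimming and ends as the center of a star;
  otherwise all degrees are at most 2 and the tree is a path. Conversely, every vertex of a path is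
  a center, and the center of a star is pulled back along the contractions.\<close>

lemma family_H_iff_spider:
  assumes T: "ugraph_tree T" "2 \<le> card (pverts T)"
  shows "T \<in> family_H \<longleftrightarrow> (\<exists>c. spider_center T c)"
proof -
  interpret sparse_connected T using T(1) by (rule ugraph_tree_sparse_connected)
  have ne: "pverts T \<noteq> {}" using T(2) by auto
  show ?thesis
  proof
    assume "T \<in> family_H"
    then consider "digraph_iso (with_proj T) (with_proj (path_graph (card (pverts T))))"
      | H k where "is_trim T H" "complete_bipartite_digraph 1 k (with_proj H)"
      unfolding family_H_def by blast
    then show "\<exists>c. spider_center T c"
    proof cases
      case 1
      have "edeg (edges T) v \<le> 2" for v
      proof (cases "v \<in> pverts T")
        case True
        then show ?thesis by (rule iso_path_graph_max_degree[OF 1])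
      next
        case False
        then have "edeg (edges T) v = 0" using edeg_eq_0[OF finite_edges] Union_edges_subset by blast
        then show ?thesis by simp
      qed
      then show ?thesis using ne unfolding spider_center_def by blast
    next
      case 2
      then show ?thesis using trim_steps_facts[of H] star_spider_center unfolding is_trim_def by blast
    qed
  next
    assume "\<exists>c. spider_center T c"
    then obtain c where c: "spider_center T c" by blast
    show "T \<in> family_H"
    proof (cases "3 \<le> edeg (edges T) c")
      case True
      then show ?thesis using spider_trims_to_star[OF c] T unfolding family_H_def by blast
    next
      case False
      then have "edeg (edges T) v \<le> 2" for v
        using c unfolding spider_center_def by (cases "v = c") auto
      then show ?thesis using iso_path_graph ne T unfolding family_H_def by blast
    qed
  qed
qed

theorem theorem5:
  fixes T :: "'a pair_pre_digraph"
  assumes "ugraph_tree T"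
    and "2 \<le> card (pverts T)"
  shows "total_forcing_number T \<ge> forcing_number T + 1 \<and>
         (total_forcing_number T = forcing_number T + 1 \<longleftrightarrow> T \<in> family_H)"
proof -
  interpret sparse_connected T using assms(1) by (rule ugraph_tree_sparse_connected)
  show ?thesis
    using total_forcing_number_bounds[OF assms(2)] family_H_iff_spider[OF assms] by blast
qed

end
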